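(* Let $\mathbb{F}\in\{\mathbb{R},\mathbb{C}\}$, $d\geq 1$, $H=\mathbb{F}^d$, and let $p,q,r$ be distinct atoms. For $\mathrm{SEP}\text{-}1 := (p\wedge(q\vee r))\wedge \neg\bigl((p\wedge q)\vee(p\wedge r)\bigr)$ we have $\neg\mathrm{Sat}_{\mathrm{PBA}}^d(\mathrm{SEP}\text{-}1)$.
   Context: $\mathrm{Proj}(H)$ is the set of orthogonal projectors on $H=\mathbb{F}^d$ (standard inner product). Formulas are built from atoms by $\varphi ::= p_i \mid \neg\varphi \mid (\varphi\wedge\psi)\mid(\varphi\vee\psi)$. PBA semantics: for a projector valuation $v$ (atoms $\to\mathrm{Proj}(H)$), values $[\![\cdot]\!]^{\mathrm{PBA}}_v$ are defined recursively and partially: $[\![p_i]\!]=v(p_i)$; $[\![\neg\theta]\!]=I-[\![\theta]\!]$ if $[\![\theta]\!]$ is defined; $[\![\alpha\wedge\beta]\!]=[\![\alpha]\!][\![\beta]\!]$ and $[\![\alpha\vee\beta]\!]=[\![\alpha]\!]+[\![\beta]\!]-[\![\alpha]\!][\![\beta]\!]$, each defined only if $[\![\alpha]\!],[\![\beta]\!]$ are both defined and commute. $\mathrm{Sat}_{\mathrm{PBA}}^d(\varphi)$ means some projector valuation makes $[\![\varphi]\!]^{\mathrm{PBA}}_v$ defined and nonzero. *)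

theory Defs
  imports "Jordan_Normal_Form.Schur_Decomposition"
begin

datatype form =
    Atom nat
  | Neg form
  | Conj form form
  | Disj form form

text \<open>Operators on \<open>H = F\<^sup>d\<close> are \<open>d \<times> d\<close> matrices acting by left multiplication.
  The constant \<^const>\<open>mat_adjoint\<close> is the conjugate transpose, i.e. the adjoint for the standard
  inner product (conjugation is trivial on the reals); see \<open>Proj_iff_inner\<close> below.\<close>

definition Proj :: "nat \<Rightarrow> 'F :: conjugatable_field mat set" where
  "Proj d = {P \<in> carrier_mat d d. P * P = P \<and> mat_adjoint P = P}"

fun pba_val :: "nat \<Rightarrow> (nat \<Rightarrow> 'F :: conjugatable_field mat) \<Rightarrow> form \<Rightarrow> 'F mat option" where
  "pba_val d v (Atom i) = Some (v i)"
| "pba_val d v (Neg \<theta>) =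
     (case pba_val d v \<theta> of None \<Rightarrow> None | Some A \<Rightarrow> Some (1\<^sub>m d - A))"
| "pba_val d v (Conj \<alpha> \<beta>) =
     (case (pba_val d v \<alpha>, pba_val d v \<beta>) of
        (Some A, Some B) \<Rightarrow> if A * B = B * A then Some (A * B) else None
      | _ \<Rightarrow> None)"
| "pba_val d v (Disj \<alpha> \<beta>) =
     (case (pba_val d v \<alpha>, pba_val d v \<beta>) of
        (Some A, Some B) \<Rightarrow> if A * B = B * A then Some (A + B - A * B) else None
      | _ \<Rightarrow> None)"

text \<open>The type argument selects the scalar field.\<close>

definition sat_pba :: "'F :: conjugatable_field itself \<Rightarrow> nat \<Rightarrow> form \<Rightarrow> bool" where
  "sat_pba _ d \<phi> \<longleftrightarrow>
     (\<exists>v :: nat \<Rightarrow> 'F mat. (\<forall>i. v i \<in> Proj d) \<and>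
        (\<exists>A. pba_val d v \<phi> = Some A \<and> A \<noteq> 0\<^sub>m d d))"

definition sep1 :: "nat \<Rightarrow> nat \<Rightarrow> nat \<Rightarrow> form" where
  "sep1 p q r =
     Conj (Conj (Atom p) (Disj (Atom q) (Atom r)))
          (Neg (Disj (Conj (Atom p) (Atom q)) (Conj (Atom p) (Atom r))))"

lemma mat_adjoint_index:
  assumes "A \<in> carrier_mat n m" "i < m" "j < n"
  shows "mat_adjoint A $$ (i, j) = conjugate (A $$ (j, i))"
  using assms by (auto simp: mat_adjoint_def mat_of_rows_def)

lemma mat_adjoint_carrier:
  "A \<in> carrier_mat n m \<Longrightarrow> mat_adjoint A \<in> carrier_mat m n"
  by (auto simp: mat_adjoint_def)

lemma inner_mult_left:
  assumes "A \<in> carrier_mat d d" "x \<in> carrier_vec d" "y \<in> carrier_vec d"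
  shows "(A *\<^sub>v x) \<bullet>c y = (\<Sum>i<d. \<Sum>j<d. A $$ (i, j) * x $ j * conjugate (y $ i))"
  using assms
  by (auto simp: scalar_prod_def atLeast0LessThan sum_distrib_right intro!: sum.cong)

lemma inner_mult_right:
  fixes A :: "'F :: conjugatable_field mat"
  assumes "A \<in> carrier_mat d d" "x \<in> carrier_vec d" "y \<in> carrier_vec d"
  shows "x \<bullet>c (A *\<^sub>v y) = (\<Sum>i<d. \<Sum>j<d. x $ i * (conjugate (A $$ (i, j)) * conjugate (y $ j)))"
  using assms
  by (auto simp: scalar_prod_def atLeast0LessThan sum_distrib_left sum_conjugate
      conjugate_dist_mul intro!: sum.cong)

lemma adjoint_inner:
  fixes A :: "'F :: conjugatable_field mat"
  assumes "A \<in> carrier_mat d d" "x \<in> carrier_vec d" "y \<in> carrier_vec d"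
  shows "(mat_adjoint A *\<^sub>v x) \<bullet>c y = x \<bullet>c (A *\<^sub>v y)"
proof -
  have "(mat_adjoint A *\<^sub>v x) \<bullet>c y
      = (\<Sum>i<d. \<Sum>j<d. conjugate (A $$ (j, i)) * x $ j * conjugate (y $ i))"
    unfolding inner_mult_left[OF mat_adjoint_carrier[OF assms(1)] assms(2,3)]
    by (intro sum.cong) (use assms in \<open>auto simp: mat_adjoint_index\<close>)
  also have "\<dots> = (\<Sum>j<d. \<Sum>i<d. conjugate (A $$ (j, i)) * x $ j * conjugate (y $ i))"
    by (rule sum.swap)
  also have "\<dots> = x \<bullet>c (A *\<^sub>v y)"
    using assms by (simp add: inner_mult_right mult_ac)
  finally show ?thesis .
qed

lemma inner_unit:
  fixes A :: "'F :: conjugatable_field mat"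
  assumes "A \<in> carrier_mat d d" "i < d" "j < d"
  shows "(A *\<^sub>v unit_vec d j) \<bullet>c unit_vec d i = A $$ (i, j) * conjugate 1"
proof -
  have e: "conjugate (unit_vec d i $ k) = (if k = i then conjugate 1 else (0 :: 'F))"
    if "k < d" for k
    using assms that by (simp add: unit_vec_def)
  have f: "A $$ (k, l) * unit_vec d j $ l = (if l = j then A $$ (k, l) else 0)"
    if "l < d" for k l
    using assms that by (simp add: unit_vec_def)
  have "(A *\<^sub>v unit_vec d j) \<bullet>c unit_vec d i
     = (\<Sum>k<d. \<Sum>l<d. A $$ (k, l) * unit_vec d j $ l * conjugate (unit_vec d i $ k))"
    using assms by (intro inner_mult_left) auto
  also have "\<dots> = (\<Sum>k<d. \<Sum>l<d. if l = j then (if k = i then A $$ (k, l) * conjugate 1 else 0) else 0)"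
    by (intro sum.cong refl) (simp only: lessThan_iff e f, auto)
  also have "\<dots> = A $$ (i, j) * conjugate 1"
    using assms by simp
  finally show ?thesis .
qed

lemma Proj_iff_inner:
  fixes P :: "'F :: conjugatable_field mat"
  shows "P \<in> Proj d \<longleftrightarrow> P \<in> carrier_mat d d \<and> P * P = P \<and>
    (\<forall>x \<in> carrier_vec d. \<forall>y \<in> carrier_vec d. (P *\<^sub>v x) \<bullet>c y = x \<bullet>c (P *\<^sub>v y))"
proof
  assume "P \<in> Proj d"
  then show "P \<in> carrier_mat d d \<and> P * P = P \<and>
    (\<forall>x \<in> carrier_vec d. \<forall>y \<in> carrier_vec d. (P *\<^sub>v x) \<bullet>c y = x \<bullet>c (P *\<^sub>v y))"
    unfolding Proj_def using adjoint_inner[of P d] by auto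
next
  assume a: "P \<in> carrier_mat d d \<and> P * P = P \<and>
    (\<forall>x \<in> carrier_vec d. \<forall>y \<in> carrier_vec d. (P *\<^sub>v x) \<bullet>c y = x \<bullet>c (P *\<^sub>v y))"
  then have P: "P \<in> carrier_mat d d" by blast
  have c: "conjugate (1 :: 'F) \<noteq> 0" by simp
  have "mat_adjoint P = P"
  proof (rule eq_matI)
    fix i j assume "i < dim_row P" "j < dim_col P"
    then have ij: "i < d" "j < d" using P by auto
    have "(mat_adjoint P *\<^sub>v unit_vec d j) \<bullet>c unit_vec d i = (P *\<^sub>v unit_vec d j) \<bullet>c unit_vec d i"
      using a adjoint_inner[OF P, of "unit_vec d j" "unit_vec d i"] by simp
    then show "mat_adjoint P $$ (i, j) = P $$ (i, j)"
      using inner_unit[OF P ij] inner_unit[OF mat_adjoint_carrier[OF P] ij] c by simp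
  qed (use P mat_adjoint_carrier[OF P] in auto)
  then show "P \<in> Proj d" using a by (simp add: Proj_def)
qed

end

theory Submission
  imports Defs
begin

text \<open>
  Where SEP-1 is defined, the commutations it forces make \<open>p \<and> (q \<or> r)\<close> and
  \<open>(p \<and> q) \<or> (p \<and> r)\<close> evaluate to the same idempotent \<open>E\<close>, so SEP-1 itself evaluates to
  \<open>E (I - E) = 0\<close>.
\<close>

text \<open>Commutation swaps the inner \<open>B * A\<close>, which brings equal factors together
  for idempotence to merge.\<close>

lemma commuting_idempotents_mult:
  fixes A B :: "'a :: semiring_1 mat"
  assumes A: "A \<in> carrier_mat n n" and B: "B \<in> carrier_mat n n"
    and "A * A = A" "B * B = B" "A * B = B * A"
  shows "(A * B) * (A * B) = A * B"
proof -
  have "(A * B) * (A * B) = A * ((B * A) * B)"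
    using A B by (simp add: assoc_mult_mat[of _ n n _ n _ n])
  also have "\<dots> = A * ((A * B) * B)"
    using assms by simp
  also have "\<dots> = (A * A) * (B * B)"
    using A B by (simp add: assoc_mult_mat[of _ n n _ n _ n])
  finally show ?thesis using assms by simp
qed

text \<open>The join absorbs each of its arguments: with \<open>S\<close> the join,
  \<open>S * A = A\<close> and \<open>S * B = B\<close>.\<close>

lemma commuting_idempotents_join:
  fixes A B :: "'a :: ring_1 mat"
  assumes A: "A \<in> carrier_mat n n" and B: "B \<in> carrier_mat n n"
    and AA: "A * A = A" and BB: "B * B = B" and AB: "A * B = B * A"
  shows "(A + B - A * B) * (A + B - A * B) = A + B - A * B"
proof -
  define S where "S = A + B - A * B"
  have S: "S \<in> carrier_mat n n" unfolding S_def by (intro minus_carrier_mat mult_carrier_mat[OF A B])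
  have "(A * B) * A = A * (A * B)"
    using assoc_mult_mat[OF A B A] AB by simp
  also have "\<dots> = (A * A) * B"
    using A B by (simp add: assoc_mult_mat[of _ n n _ n _ n])
  finally have "(A * B) * A = (A * A) * B" .
  then have "S * A = A + A * B - A * B"
    using A B AA AB by (simp add: S_def minus_mult_distrib_mat[of _ n n _ _ n]
        add_mult_distrib_mat[of _ n n _ _ n])
  also have "\<dots> = A" using A B by (intro eq_matI) auto
  finally have SA: "S * A = A" .
  have "(A * B) * B = A * B"
    using A B BB by (simp add: assoc_mult_mat[of _ n n _ n _ n])
  then have "S * B = A * B + B - A * B"
    using A B BB by (simp add: S_def minus_mult_distrib_mat[of _ n n _ _ n]
        add_mult_distrib_mat[of _ n n _ _ n])
  also have "\<dots> = B" using A B by (intro eq_matI) auto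
  finally have SB: "S * B = B" .
  \<comment> \<open>Only the right-hand copy of \<open>S\<close> is expanded, so that the absorption
    laws can act on every term.\<close>
  have "S * (A + B - A * B) = S * A + S * B - (S * A) * B"
    using S A B by (simp add: mult_minus_distrib_mat[of _ n n _ n]
        mult_add_distrib_mat[of _ n n _ n] assoc_mult_mat[of _ n n _ n _ n])
  then show ?thesis unfolding SA SB by (simp only: S_def)
qed

lemma Proj_idem: "P \<in> Proj d \<Longrightarrow> P * P = P"
  by (simp add: Proj_def)

lemma Proj_carrier: "P \<in> Proj d \<Longrightarrow> P \<in> carrier_mat d d"
  by (simp add: Proj_def)

text \<open>Moving \<open>P\<close> past \<open>Q\<close> makes the two copies of \<open>P\<close>
  in the product term adjacent, and idempotence leaves one; \<open>P\<close> then factors out on the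
  left.\<close>

lemma distributed_join_eq:
  fixes P Q R :: "'a :: ring_1 mat"
  assumes P: "P \<in> carrier_mat n n" and Q: "Q \<in> carrier_mat n n" and R: "R \<in> carrier_mat n n"
    and PP: "P * P = P" and PQ: "P * Q = Q * P"
  shows "P * Q + P * R - (P * Q) * (P * R) = P * (Q + R - Q * R)"
proof -
  have "(P * Q) * (P * R) = P * ((Q * P) * R)"
    using P Q R by (simp add: assoc_mult_mat[of _ n n _ n _ n])
  also have "\<dots> = P * ((P * Q) * R)"
    by (simp only: PQ)
  also have "\<dots> = (P * P) * (Q * R)"
    using P Q R by (simp add: assoc_mult_mat[of _ n n _ n _ n])
  finally have "(P * Q) * (P * R) = P * (Q * R)"
    by (simp only: PP)
  then show ?thesis
    using P Q R by (simp add: mult_minus_distrib_mat[of _ n n _ n]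
        mult_add_distrib_mat[of _ n n _ n])
qed

text \<open>The argument is purely ring-theoretic, so one proof over a general conjugatable field
  covers both the real and the complex case.\<close>

lemma not_sat_pba_sep1:
  "\<not> sat_pba TYPE('F :: conjugatable_field) d (sep1 p q r)"
proof
  assume "sat_pba TYPE('F) d (sep1 p q r)"
  then obtain v :: "nat \<Rightarrow> 'F mat" and A where v: "\<And>i. v i \<in> Proj d"
    and val: "pba_val d v (sep1 p q r) = Some A" and A0: "A \<noteq> 0\<^sub>m d d"
    unfolding sat_pba_def by blast
  define S where "S = v q + v r - v q * v r"
  define E where "E = v p * S"
  note carr = Proj_carrier[OF v] and idem = Proj_idem[OF v]
  \<comment> \<open>A defined value means that every commutation test succeeded: \<open>qr\<close>
    comes from the disjunction of \<open>q\<close> and \<open>r\<close>, \<open>pS\<close> from its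
    conjunction with \<open>p\<close>, and \<open>pq\<close> from the conjunction of
    \<open>p\<close> and \<open>q\<close>.\<close>
  have qr: "v q * v r = v r * v q" and pS: "v p * S = S * v p" and pq: "v p * v q = v q * v p"
    and A: "A = E * (1\<^sub>m d - (v p * v q + v p * v r - (v p * v q) * (v p * v r)))"
    using val by (auto simp: sep1_def S_def E_def split: if_splits)
  have S: "S \<in> carrier_mat d d" unfolding S_def by (intro minus_carrier_mat mult_carrier_mat[OF carr carr])
  then have E: "E \<in> carrier_mat d d" unfolding E_def by (intro mult_carrier_mat[OF carr S])
  have "S * S = S"
    unfolding S_def by (rule commuting_idempotents_join[OF carr carr idem idem qr])
  then have EE: "E * E = E"
    unfolding E_def by (intro commuting_idempotents_mult[OF carr S idem _ pS])
  \<comment> \<open>Distributivity identifies the negated disjunction's argument with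
    \<open>E\<close> as well.\<close>
  have "A = E * (1\<^sub>m d - E)"
    unfolding A distributed_join_eq[OF carr carr carr idem pq] E_def S_def ..
  also have "\<dots> = E * 1\<^sub>m d - E * E"
    using E by (intro mult_minus_distrib_mat) auto
  also have "\<dots> = 0\<^sub>m d d" using E EE by auto
  finally show False using A0 by contradiction
qed

theorem mainTheorem6:
  fixes d p q r :: nat
  assumes "d \<ge> 1" and "p \<noteq> q" and "p \<noteq> r" and "q \<noteq> r"
  shows "\<not> sat_pba TYPE(real) d (sep1 p q r) \<and> \<not> sat_pba TYPE(complex) d (sep1 p q r)"
  by (simp add: not_sat_pba_sep1)

end
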